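(* Let $R>0$ and let $(a_n)_{n\ge 0}$ be real numbers such that, with $r=\sqrt{\rho^2+z^2}$ and $x=z/r$, the series $$\lambda(r,x)=-\sum_{n=0}^{\infty}a_n\frac{P_n(x)}{r^{n+1}},$$ $$\mu(r,x)=-\sum_{n,m=0}^{\infty}\frac{(n+1)(m+1)a_na_m}{n+m+2}\,\frac{P_n(x)P_m(x)-P_{n+1}(x)P_{m+1}(x)}{r^{n+m+2}}$$ converge absolutely and uniformly for $r\ge R$, $x\in[-1,1]$ (so $\lambda$ is an asymptotically flat multipole solution of the axisymmetric Laplace equation $\lambda_{\rho\rho}+\lambda_\rho/\rho+\lambda_{zz}=0$, and $\mu$ is its companion potential). Suppose that there are real constants $c$, $(f_k)_{k\ge1}$, $(g_k)_{k\ge1}$ such that the series $$F(\rho)=1-c+\sum_{k=1}^\infty f_k\rho^{-k},\qquad G(z)=c+\sum_{k=1}^\infty g_kz^{-k}$$ converge absolutely for $\rho\ge R$ and $|z|\ge R$ respectively, and $$e^{2(\mu-\lambda)}=F(\rho)+G(z)\qquad\text{for all }\rho>R,\ |z|>R .$$ Then $a_n=0$ for all $n\ge 0$; that is, $\lambda=\mu=0$ and the metric $ds^2=e^{2\lambda}dt^2-e^{-2\lambda}[\rho^2d\phi^2+e^{2\mu}(d\rho^2+dz^2)]$ is flat.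
   Context: $P_n$ denotes the $n$-th Legendre polynomial. Weyl's canonical coordinates are $(t,\phi,\rho,z)$ with $\rho>0$; $\rho=r\sqrt{1-x^2}$, $z=rx$, $x=\cos\theta$. A static axisymmetric vacuum metric of Weyl's class is $ds^2=e^{2\lambda}dt^2-e^{-2\lambda}[\rho^2d\phi^2+e^{2\mu}(d\rho^2+dz^2)]$ with $\lambda,\mu$ functions of $(\rho,z)$ satisfying $\lambda_{\rho\rho}+\lambda_\rho/\rho+\lambda_{zz}=0$, $\mu_\rho=\rho(\lambda_\rho^2-\lambda_z^2)$, $\mu_z=2\rho\lambda_\rho\lambda_z$. The displayed series for $\mu$ is the solution of the last two equations with $\mu\to0$ as $r\to\infty$ for the displayed $\lambda$. *)

theory Defs
  imports
    "HOL-Analysis.Analysis"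
    "HOL-Computational_Algebra.Polynomial"
begin

(* Rodrigues' formula: P_n(x) = 1/(2^n n!) (d/dx)^n (x^2 - 1)^n. *)
definition legendre :: "nat \<Rightarrow> real poly" where
  "legendre n = smult (1 / (2 ^ n * fact n)) ((pderiv ^^ n) ([:-1, 0, 1:] ^ n))"

definition lambda_term :: "(nat \<Rightarrow> real) \<Rightarrow> nat \<Rightarrow> real \<Rightarrow> real \<Rightarrow> real" where
  "lambda_term a n r x = a n * poly (legendre n) x / r ^ (n + 1)"

definition mu_term :: "(nat \<Rightarrow> real) \<Rightarrow> nat \<Rightarrow> nat \<Rightarrow> real \<Rightarrow> real \<Rightarrow> real" where
  "mu_term a n m r x =
     (real n + 1) * (real m + 1) * a n * a m / (real n + real m + 2) *
     ((poly (legendre n) x * poly (legendre m) x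
       - poly (legendre (n + 1)) x * poly (legendre (m + 1)) x) / r ^ (n + m + 2))"

definition multipole_lambda :: "(nat \<Rightarrow> real) \<Rightarrow> real \<Rightarrow> real \<Rightarrow> real" where
  "multipole_lambda a r x = - (\<Sum>n. lambda_term a n r x)"

definition multipole_mu :: "(nat \<Rightarrow> real) \<Rightarrow> real \<Rightarrow> real \<Rightarrow> real" where
  "multipole_mu a r x = - (\<Sum>\<^sub>\<infinity>(n, m)\<in>UNIV. mu_term a n m r x)"

definition series_converges_abs_unif_on ::
    "'p set \<Rightarrow> (nat \<Rightarrow> 'p \<Rightarrow> real) \<Rightarrow> bool" where
  "series_converges_abs_unif_on S u \<longleftrightarrow>
     (\<forall>p\<in>S. summable (\<lambda>n. \<bar>u n p\<bar>)) \<and>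
     uniform_limit S (\<lambda>N p. \<Sum>n<N. u n p) (\<lambda>p. \<Sum>n. u n p) sequentially"

(* Uniformity refers to the rectangular partial sums, with both bounds tending
   to infinity independently. *)
definition double_series_converges_abs_unif_on ::
    "'p set \<Rightarrow> (nat \<Rightarrow> nat \<Rightarrow> 'p \<Rightarrow> real) \<Rightarrow> bool" where
  "double_series_converges_abs_unif_on S u \<longleftrightarrow>
     (\<forall>p\<in>S. (\<lambda>(n, m). \<bar>u n m p\<bar>) summable_on UNIV) \<and>
     uniform_limit S (\<lambda>(N, M) p. \<Sum>n<N. \<Sum>m<M. u n m p)
       (\<lambda>p. \<Sum>\<^sub>\<infinity>(n, m)\<in>UNIV. u n m p) (sequentially \<times>\<^sub>F sequentially)"

(* A function of (r, x), with r = sqrt (rho^2 + z^2) and x = z/r, as a function of (rho, z). *)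
definition in_weyl_coords :: "(real \<Rightarrow> real \<Rightarrow> real) \<Rightarrow> real \<Rightarrow> real \<Rightarrow> real" where
  "in_weyl_coords h \<rho> z = (let r = sqrt (\<rho>\<^sup>2 + z\<^sup>2) in h r (z / r))"

(* The coordinates (t, phi, rho, z) of a point p are p $ 1, p $ 2, p $ 3, p $ 4. *)
definition weyl_metric ::
    "(real \<Rightarrow> real \<Rightarrow> real) \<Rightarrow> (real \<Rightarrow> real \<Rightarrow> real) \<Rightarrow> real ^ 4 \<Rightarrow> real ^ 4 ^ 4" where
  "weyl_metric lam mu p =
     (let \<rho> = p $ 3; z = p $ 4; l = lam \<rho> z; m = mu \<rho> z in
      \<chi> i j. if i \<noteq> j then 0
             else if i = 1 then exp (2 * l)
             else if i = 2 then - exp (- 2 * l) * \<rho>\<^sup>2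
             else - exp (- 2 * l) * exp (2 * m))"

definition partial :: "'n::finite \<Rightarrow> (real ^ 'n \<Rightarrow> real) \<Rightarrow> real ^ 'n \<Rightarrow> real" where
  "partial i f p = deriv (\<lambda>h. f (p + h *\<^sub>R axis i 1)) 0"

(* Gamma^i_{jk} of the Levi-Civita connection *)
definition christoffel ::
    "(real ^ 'n \<Rightarrow> real ^ 'n ^ 'n) \<Rightarrow> 'n::finite \<Rightarrow> 'n \<Rightarrow> 'n \<Rightarrow> real ^ 'n \<Rightarrow> real" where
  "christoffel g i j k p =
     1 / 2 * (\<Sum>l\<in>UNIV. matrix_inv (g p) $ i $ l *
       (partial j (\<lambda>q. g q $ l $ k) p + partial k (\<lambda>q. g q $ l $ j) p
        - partial l (\<lambda>q. g q $ j $ k) p))"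

(* R^i_{jkl} = d_k Gamma^i_{lj} - d_l Gamma^i_{kj}
     + Gamma^i_{km} Gamma^m_{lj} - Gamma^i_{lm} Gamma^m_{kj} *)
definition riemann ::
    "(real ^ 'n \<Rightarrow> real ^ 'n ^ 'n) \<Rightarrow> 'n::finite \<Rightarrow> 'n \<Rightarrow> 'n \<Rightarrow> 'n \<Rightarrow> real ^ 'n \<Rightarrow> real" where
  "riemann g i j k l p =
     partial k (christoffel g i l j) p - partial l (christoffel g i k j) p
     + (\<Sum>m\<in>UNIV. christoffel g i k m p * christoffel g m l j p
                   - christoffel g i l m p * christoffel g m k j p)"

definition flat_on :: "(real ^ 'n) set \<Rightarrow> (real ^ 'n::finite \<Rightarrow> real ^ 'n ^ 'n) \<Rightarrow> bool" where
  "flat_on U g \<longleftrightarrow> (\<forall>p\<in>U. \<forall>i j k l. riemann g i j k l p = 0)"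

end

theory Submission
  imports Defs
begin

text \<open>
  Compare both sides of the separation equation along rays of fixed x as r tends to infinity.
  If a vanishes below N, and f, g vanish up to order N, then \<mu> is of order 2 N + 2 in 1/r, so the
  coefficient of order N + 1 of the left-hand side comes from \<lambda> alone. With
  \<rho> = r sqrt (1 - x^2) and z = r x this gives
  f_(N+1) / (1 - x^2)^((N+1)/2) + g_(N+1) / x^(N+1) = 2 a_N P_N(x) for 0 < x < 1.
  The right-hand side is bounded, so letting x tend to 1 and to 0 yields f_(N+1) = g_(N+1) = 0,
  and then a_N = 0 because P_N is a nonzero polynomial.
\<close>

section \<open>Leading coefficients as r tends to infinity\<close>

text \<open>In the variable u = 1/r the sum is u times a power series that converges for |u| < 1/R.
  Dropping the N vanishing terms and scaling by r^(N+1) leaves a power series with constant term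
  \<open>b N\<close>, which is its limit at u = 0. The lemma serves \<lambda>, F and G
  alike.\<close>

lemma tendsto_tail_at_top:
  fixes b :: "nat \<Rightarrow> real"
  assumes "R > 0" and summ: "summable (\<lambda>k. \<bar>b k / R ^ Suc k\<bar>)" and zero: "\<And>k. k < N \<Longrightarrow> b k = 0"
  shows "((\<lambda>r. r ^ Suc N * (\<Sum>k. b k / r ^ Suc k)) \<longlongrightarrow> b N) at_top"
proof -
  have "summable (\<lambda>k. R * (b k / R ^ Suc k))"
    by (rule summable_mult[OF summable_rabs_cancel[OF summ]])
  then have "summable (\<lambda>k. b k * (1 / R) ^ k)"
    using \<open>R > 0\<close> by (simp add: power_one_over)
  then have b_summable: "summable (\<lambda>k. b k * u ^ k)" if "norm u < 1 / R" for u
    using powser_inside[of b "1 / R" u] that \<open>R > 0\<close> by simp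
  have shift_summable: "summable (\<lambda>k. b (k + N) * u ^ k)" if "norm u < 1 / R" for u
  \<comment> \<open>Shifting the index divides by u^N, so u = 0 is treated apart.\<close>
  proof (cases "u = 0")
    case True
    then show ?thesis by (simp add: summable_0_powser)
  next
    case False
    have "summable (\<lambda>k. (1 / u ^ N) * (b (k + N) * u ^ (k + N)))"
      by (intro summable_mult summable_ignore_initial_segment[of "\<lambda>k. b k * u ^ k"] b_summable that)
    then show ?thesis using False by (simp add: power_add)
  qed
  have lim0: "((\<lambda>u. \<Sum>k. b (k + N) * u ^ k) \<longlongrightarrow> b N) (at 0)"
    using powser_limit_0[of "1 / R" "\<lambda>k. b (k + N)" "\<lambda>u. \<Sum>k. b (k + N) * u ^ k"]
      shift_summable \<open>R > 0\<close> by (simp add: summable_sums)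
  have "filterlim (\<lambda>r::real. inverse r) (at 0) at_top"
    by (rule filterlim_mono[OF filterlim_inverse_at_right_top]) (auto simp: at_le)
  from filterlim_compose[OF lim0 this]
  have "((\<lambda>r. \<Sum>k. b (k + N) * inverse r ^ k) \<longlongrightarrow> b N) at_top" .
  moreover have "\<forall>\<^sub>F r in at_top. (\<Sum>k. b (k + N) * inverse r ^ k) = r ^ Suc N * (\<Sum>k. b k / r ^ Suc k)"
    using eventually_gt_at_top[of R]
  proof eventually_elim
    case (elim r)
    have r: "r > 0" "norm (inverse r) < 1 / R"
      using elim \<open>R > 0\<close> by (auto simp: field_simps)
    have eq: "b k / r ^ Suc k = inverse r * (b k * inverse r ^ k)" for k
      by (simp add: divide_inverse power_inverse)
    have sm: "summable (\<lambda>k. b k / r ^ Suc k)"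
      unfolding eq using b_summable[OF r(2)] by (rule summable_mult)
    have "(\<Sum>k. b k / r ^ Suc k) = (\<Sum>k. b (k + N) / r ^ Suc (k + N))"
      using suminf_split_initial_segment[OF sm, of N] zero by simp
    also have "\<dots> = (\<Sum>k. (1 / r ^ Suc N) * (b (k + N) * inverse r ^ k))"
      using r by (simp add: power_add field_simps)
    also have "\<dots> = (1 / r ^ Suc N) * (\<Sum>k. b (k + N) * inverse r ^ k)"
      by (rule suminf_mult[OF shift_summable[OF r(2)]])
    finally show ?case using r by simp
  qed
  ultimately show ?thesis by (rule Lim_transform_eventually)
qed

text \<open>Since r^(N+1) is unbounded, \<open>E\<close> tends to 0, where exp y - 1 behaves like y;
  so exponentiating keeps the leading coefficient.\<close>

lemma tendsto_pow_mult_exp_minus_one: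
  fixes E :: "real \<Rightarrow> real"
  assumes "((\<lambda>r. r ^ Suc N * E r) \<longlongrightarrow> L) at_top"
  shows "((\<lambda>r. r ^ Suc N * (exp (E r) - 1)) \<longlongrightarrow> L) at_top"
proof -
  have "((\<lambda>r. (r ^ Suc N * E r) * inverse (r ^ Suc N)) \<longlongrightarrow> L * 0) at_top"
    by (intro tendsto_mult assms tendsto_inverse_0_at_top filterlim_pow_at_top filterlim_ident) simp
  moreover have "\<forall>\<^sub>F r in at_top. (r ^ Suc N * E r) * inverse (r ^ Suc N) = E r"
    using eventually_gt_at_top[of 0] by eventually_elim (simp add: field_simps)
  ultimately have E0: "(E \<longlongrightarrow> 0) at_top"
    using Lim_transform_eventually by fastforce
  \<comment> \<open>Caratheodory's form of the derivative avoids a quotient by \<open>E r\<close>,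
    which may vanish.\<close>
  obtain \<phi> where \<phi>: "\<And>y::real. exp y - 1 = \<phi> y * y" "isCont \<phi> 0" "\<phi> 0 = 1"
    using DERIV_exp[of "0::real"] unfolding CARAT_DERIV by auto
  have "((\<lambda>r. \<phi> (E r)) \<longlongrightarrow> 1) at_top"
    using isCont_tendsto_compose[OF \<phi>(2) E0] \<phi>(3) by simp
  from tendsto_mult[OF this assms] show ?thesis
    by (simp add: \<phi>(1) mult_ac)
qed

text \<open>Every surviving term has n, m \<ge> N, and passing from R to r scales it by
  (R/r)^(n+m+2) \<le> (R/r)^(2N+2). Absolute convergence at r = R alone thus gives order 2N+2 in
  1/r, which beats the factor r^(N+1) even for N = 0.\<close>

lemma multipole_mu_decay:
  assumes "R > 0" and summ: "(\<lambda>(n, m). \<bar>mu_term a n m R x\<bar>) summable_on UNIV"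
    and zero: "\<And>n. n < N \<Longrightarrow> a n = 0"
  shows "((\<lambda>r. r ^ Suc N * multipole_mu a r x) \<longlongrightarrow> 0) at_top"
proof -
  define C where "C = (\<Sum>\<^sub>\<infinity>(n, m)\<in>UNIV. \<bar>mu_term a n m R x\<bar>)"
  have bound: "\<bar>multipole_mu a r x\<bar> \<le> C * (R / r) ^ (2 * N + 2)" if r: "r > R" for r
  proof -
    have term_bound: "\<bar>mu_term a n m r x\<bar> \<le> \<bar>mu_term a n m R x\<bar> * (R / r) ^ (2 * N + 2)" for n m
    proof (cases "n < N \<or> m < N")
      case True
      then show ?thesis using zero by (auto simp: mu_term_def)
    next
      case False
      have "mu_term a n m r x = mu_term a n m R x * (R / r) ^ (n + m + 2)"
        using \<open>R > 0\<close> r by (simp add: mu_term_def power_divide)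
      moreover have "(R / r) ^ (n + m + 2) \<le> (R / r) ^ (2 * N + 2)"
        using False \<open>R > 0\<close> r by (intro power_decreasing) auto
      ultimately show ?thesis
        using \<open>R > 0\<close> r by (simp add: abs_mult mult_left_mono del: power_Suc power_Suc2 add_2_eq_Suc')
    qed
    have major: "(\<lambda>(n, m). \<bar>mu_term a n m R x\<bar> * (R / r) ^ (2 * N + 2)) summable_on UNIV"
      using summable_on_cmult_left[OF summ, of "(R / r) ^ (2 * N + 2)"]
      by (simp add: case_prod_unfold)
    have abs_summ: "(\<lambda>(n, m). \<bar>mu_term a n m r x\<bar>) summable_on UNIV"
      by (rule summable_on_comparison_test[OF major]) (use term_bound in auto)
    have "\<bar>multipole_mu a r x\<bar> \<le> (\<Sum>\<^sub>\<infinity>(n, m)\<in>UNIV. \<bar>mu_term a n m r x\<bar>)"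
      using norm_infsum_bound[of "\<lambda>(n, m). mu_term a n m r x" UNIV] abs_summ
      by (simp add: multipole_mu_def case_prod_unfold)
    also have "\<dots> \<le> (\<Sum>\<^sub>\<infinity>(n, m)\<in>UNIV. \<bar>mu_term a n m R x\<bar> * (R / r) ^ (2 * N + 2))"
      by (rule infsum_mono[OF abs_summ major]) (use term_bound in auto)
    also have "\<dots> = C * (R / r) ^ (2 * N + 2)"
      unfolding C_def by (simp only: case_prod_unfold infsum_cmult_left')
    finally show ?thesis .
  qed
  have "((\<lambda>r. C * R ^ (2 * N + 2) * inverse (r ^ Suc N)) \<longlongrightarrow> C * R ^ (2 * N + 2) * 0) at_top"
    by (intro tendsto_mult tendsto_const tendsto_inverse_0_at_top filterlim_pow_at_top filterlim_ident) simp
  then have major: "((\<lambda>r. C * R ^ (2 * N + 2) * inverse (r ^ Suc N)) \<longlongrightarrow> 0) at_top"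
    by simp
  show ?thesis
  proof (rule Lim_null_comparison[OF _ major])
    show "\<forall>\<^sub>F r in at_top. norm (r ^ Suc N * multipole_mu a r x) \<le> C * R ^ (2 * N + 2) * inverse (r ^ Suc N)"
      using eventually_gt_at_top[of R]
    proof eventually_elim
      case (elim r)
      then have "r > 0" using \<open>R > 0\<close> by simp
      have "norm (r ^ Suc N * multipole_mu a r x) \<le> r ^ Suc N * (C * (R / r) ^ (2 * N + 2))"
        using mult_left_mono[OF bound[OF elim], of "r ^ Suc N"] \<open>r > 0\<close> by (simp only: abs_mult real_norm_def) simp
      also have "(R / r) ^ (2 * N + 2) = R ^ (2 * N + 2) / (r ^ Suc N * r ^ Suc N)"
        by (simp add: power_divide power_add[symmetric] mult_2)
      finally show ?case using \<open>r > 0\<close> by (simp add: field_simps)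
    qed
  qed
qed

section \<open>Legendre polynomials and the limiting identity in x\<close>

lemma degree_pderiv_funpow:
  fixes p :: "real poly"
  shows "degree ((pderiv ^^ n) p) = degree p - n"
  by (induction n) (simp_all add: degree_pderiv)

text \<open>The n-th derivative of a polynomial of degree 2n has degree n. A nonzero degree excludes
  the zero polynomial, but this says nothing for n = 0, hence the case split.\<close>

lemma legendre_nonzero: "legendre n \<noteq> 0"
proof (cases "n = 0")
  case False
  have "degree ([:-1, 0, 1:] ^ n :: real poly) = 2 * n"
    by (simp add: degree_power_eq)
  then have "degree ((pderiv ^^ n) ([:-1, 0, 1:] ^ n :: real poly)) \<noteq> 0"
    using False by (simp add: degree_pderiv_funpow)
  then show ?thesis by (auto simp: legendre_def)
qed (simp add: legendre_def)

text \<open>The polynomial stays bounded, whereas the \<alpha> term would blow up at x = 1 and the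
  \<beta> term at x = 0. Once both are gone, \<open>p\<close> has infinitely many roots in
  (0,1).\<close>

lemma separated_homogeneous_eq_poly_imp_zero:
  fixes p :: "real poly"
  assumes eq: "\<And>x. 0 < x \<Longrightarrow> x < 1 \<Longrightarrow> \<alpha> / sqrt (1 - x\<^sup>2) ^ Suc N + \<beta> / x ^ Suc N = poly p x"
  shows "\<alpha> = 0" "\<beta> = 0" "p = 0"
proof -
  have sq: "1 - x\<^sup>2 > 0" if "0 < x" "x < 1" for x :: real
    using that power_less_one_iff[of x 2] by simp
  have near1: "\<forall>\<^sub>F x in at_left 1. 0 < x \<and> x < (1::real)"
    using eventually_at_left_real[of 0 "1::real"] by simp
  have near0: "\<forall>\<^sub>F x in at_right 0. 0 < x \<and> x < (1::real)"
    using eventually_at_right_real[of 0 "1::real"] by simp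
  \<comment> \<open>Clearing the singular denominator leaves the constant \<alpha> on one side; the
    limit is 0 because the exponent of the vanishing root is positive.\<close>
  have "((\<lambda>x. (poly p x - \<beta> / x ^ Suc N) * sqrt (1 - x\<^sup>2) ^ Suc N)
      \<longlongrightarrow> (poly p 1 - \<beta> / 1 ^ Suc N) * sqrt (1 - 1\<^sup>2) ^ Suc N) (at_left 1)"
    by (intro tendsto_intros) auto
  moreover have "\<forall>\<^sub>F x in at_left 1. (poly p x - \<beta> / x ^ Suc N) * sqrt (1 - x\<^sup>2) ^ Suc N = \<alpha>"
    using near1 by eventually_elim (use sq in \<open>force simp: eq[symmetric] simp del: power_Suc\<close>)
  ultimately have "((\<lambda>x::real. \<alpha>) \<longlongrightarrow> 0) (at_left 1)"
    using Lim_transform_eventually by fastforce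
  then show \<alpha>: "\<alpha> = 0"
    by (simp add: tendsto_const_iff)
  have "((\<lambda>x. poly p x * x ^ Suc N) \<longlongrightarrow> poly p 0 * 0 ^ Suc N) (at_right 0)"
    by (intro tendsto_intros)
  moreover have "\<forall>\<^sub>F x in at_right 0. poly p x * x ^ Suc N = \<beta>"
    using near0 by eventually_elim (auto simp: eq[symmetric] \<alpha> simp del: power_Suc)
  ultimately have "((\<lambda>x::real. \<beta>) \<longlongrightarrow> 0) (at_right 0)"
    using Lim_transform_eventually by fastforce
  then show \<beta>: "\<beta> = 0"
    by (simp add: tendsto_const_iff)
  show "p = 0"
  proof (rule ccontr)
    assume "p \<noteq> 0"
    then have "finite {x. poly p x = 0}" by (rule poly_roots_finite)
    moreover have "{0<..<1::real} \<subseteq> {x. poly p x = 0}"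
      using eq \<alpha> \<beta> by auto
    ultimately show False
      using finite_subset infinite_Ioo[OF zero_less_one] by blast
  qed
qed

section \<open>Flatness of Minkowski space in cylindrical coordinates\<close>

text \<open>Closed forms of the Christoffel symbols hold only off the axis \<rho> = 0, so
  differentiating them needs agreement on an open set.\<close>

lemma partial_cong_open:
  assumes "open U" "p \<in> U" "\<And>q. q \<in> U \<Longrightarrow> F q = G q"
  shows "partial i F p = partial i G p"
proof -
  have "((\<lambda>h. p + h *\<^sub>R axis i 1) \<longlongrightarrow> p + 0 *\<^sub>R axis i 1) (nhds 0)"
    by (intro tendsto_intros filterlim_ident)
  then have "\<forall>\<^sub>F h in nhds 0. p + h *\<^sub>R axis i 1 \<in> U"
    using assms(1,2) by (intro topological_tendstoD) auto
  then have "\<forall>\<^sub>F h in nhds 0. F (p + h *\<^sub>R axis i 1) = G (p + h *\<^sub>R axis i 1)"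
    by eventually_elim (rule assms(3))
  then show ?thesis
    unfolding partial_def by (intro deriv_cong_ev) auto
qed

lemma partial_component:
  assumes "(\<phi> has_field_derivative D) (at (p $ m))"
  shows "partial i (\<lambda>q. \<phi> (q $ m)) p = (if i = m then D else 0)"
proof (cases "i = m")
  case True
  have "((\<lambda>h. \<phi> (p $ m + h)) has_field_derivative D) (at 0)"
    using assms DERIV_shift[of \<phi> D 0 "p $ m"] by (simp add: add.commute)
  then show ?thesis
    using True by (simp add: partial_def axis_def DERIV_imp_deriv)
next
  case False
  then show ?thesis by (simp add: partial_def axis_def)
qed

lemma partial_const [simp]: "partial i (\<lambda>q. c) p = 0"
  by (simp add: partial_def)

text \<open>\<open>matrix_inv\<close> is defined by choice. \<open>B\<close> witnesses that the
  chosen matrix is an inverse, and multiplication by \<open>B\<close> on the left identifies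
  it.\<close>

lemma matrix_inv_unique:
  fixes A :: "'a::semiring_1 ^ 'n ^ 'm"
  assumes AB: "A ** B = mat 1" and BA: "B ** A = mat 1"
  shows "matrix_inv A = B"
proof -
  have "A ** matrix_inv A = mat 1"
    unfolding matrix_inv_def by (rule someI2[of _ B]) (use assms in auto)
  then have "B ** A ** matrix_inv A = B"
    by (simp add: matrix_mul_assoc[symmetric])
  then show ?thesis by (simp add: BA)
qed

text \<open>The Minkowski metric dt^2 - \<rho>^2 d\<phi>^2 - d\<rho>^2 - dz^2.\<close>

definition cylinder_metric :: "real ^ 4 \<Rightarrow> real ^ 4 ^ 4" where
  "cylinder_metric = weyl_metric (\<lambda>_ _. 0) (\<lambda>_ _. 0)"

lemma cylinder_metric_nth:
  "cylinder_metric p $ i $ j =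
     (if i \<noteq> j then 0 else if i = 1 then 1 else if i = 2 then - (p $ 3)\<^sup>2 else - 1)"
  by (simp add: cylinder_metric_def weyl_metric_def Let_def)

lemma matrix_inv_cylinder_metric:
  assumes "p $ 3 \<noteq> 0"
  shows "matrix_inv (cylinder_metric p) $ i $ j =
     (if i \<noteq> j then 0 else if i = 1 then 1 else if i = 2 then - 1 / (p $ 3)\<^sup>2 else - 1)"
proof -
  define B :: "real ^ 4 ^ 4" where
    "B = (\<chi> i j. if i \<noteq> j then 0 else if i = 1 then 1 else if i = 2 then - 1 / (p $ 3)\<^sup>2 else - 1)"
  have "cylinder_metric p ** B = mat 1" "B ** cylinder_metric p = mat 1"
    using assms
    by (auto simp: vec_eq_iff matrix_matrix_mult_def cylinder_metric_nth B_def mat_def forall_4 sum_4)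
  then have "matrix_inv (cylinder_metric p) = B"
    by (rule matrix_inv_unique)
  then show ?thesis by (simp add: B_def)
qed

lemma partial_cylinder_metric:
  "partial l (\<lambda>q. cylinder_metric q $ i $ j) p = (if i = 2 \<and> j = 2 \<and> l = 3 then - 2 * p $ 3 else 0)"
proof (cases "i = 2 \<and> j = 2")
  case True
  have "((\<lambda>t. - t\<^sup>2) has_field_derivative - 2 * p $ 3) (at (p $ 3))"
    by (auto intro!: derivative_eq_intros)
  from partial_component[OF this, of l] True show ?thesis
    by (simp add: cylinder_metric_nth)
next
  case False
  then have "(\<lambda>q. cylinder_metric q $ i $ j) = (\<lambda>q. if i \<noteq> j then 0 else if i = 1 then 1 else - 1)"
    by (auto simp: cylinder_metric_nth)
  with False show ?thesis by auto
qed

text \<open>These are the symbols of plane polar coordinates: the minus sign of the spatial block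
  cancels between the inverse metric and the derivatives.\<close>

lemma christoffel_cylinder_metric:
  assumes "p $ 3 \<noteq> 0"
  shows "christoffel cylinder_metric i j k p =
    (if i = 2 \<and> (j = 2 \<and> k = 3 \<or> j = 3 \<and> k = 2) then 1 / p $ 3
     else if i = 3 \<and> j = 2 \<and> k = 2 then - p $ 3 else 0)"
  using assms exhaust_4[of i] exhaust_4[of j] exhaust_4[of k]
  by (auto simp: christoffel_def sum_4 matrix_inv_cylinder_metric partial_cylinder_metric
      power2_eq_square)

lemma partial_christoffel_cylinder_metric:
  assumes "p $ 3 > 0"
  shows "partial l (christoffel cylinder_metric i j k) p =
    (if l \<noteq> 3 then 0
     else if i = 2 \<and> (j = 2 \<and> k = 3 \<or> j = 3 \<and> k = 2) then - 1 / (p $ 3)\<^sup>2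
     else if i = 3 \<and> j = 2 \<and> k = 2 then - 1 else 0)"
proof -
  \<comment> \<open>With the indices fixed, the symbol depends on \<rho> alone.\<close>
  define \<phi> :: "real \<Rightarrow> real" where
    "\<phi> t = (if i = 2 \<and> (j = 2 \<and> k = 3 \<or> j = 3 \<and> k = 2) then 1 / t
      else if i = 3 \<and> j = 2 \<and> k = 2 then - t else 0)" for t
  define D where
    "D = (if i = 2 \<and> (j = 2 \<and> k = 3 \<or> j = 3 \<and> k = 2) then - 1 / (p $ 3)\<^sup>2
      else if i = 3 \<and> j = 2 \<and> k = 2 then - 1 else 0)"
  have "open {q :: real ^ 4. q $ 3 > 0}"
    by (rule open_halfspace_component_gt_cart)
  then have "partial l (christoffel cylinder_metric i j k) p = partial l (\<lambda>q. \<phi> (q $ 3)) p"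
    by (rule partial_cong_open) (use assms in \<open>auto simp: christoffel_cylinder_metric \<phi>_def\<close>)
  also have "(\<phi> has_field_derivative D) (at (p $ 3))"
    unfolding \<phi>_def D_def using assms
    by (auto intro!: derivative_eq_intros simp: power2_eq_square)
  then have "partial l (\<lambda>q. \<phi> (q $ 3)) p = (if l = 3 then D else 0)"
    by (rule partial_component)
  finally show ?thesis by (simp add: D_def)
qed

text \<open>Up to antisymmetry in \<open>k\<close>, \<open>l\<close>, derivatives enter in two
  components only. There -1/\<rho>^2 cancels against the square of 1/\<rho>, and -1 against
  -(-\<rho>)(1/\<rho>) = 1.\<close>

lemma riemann_cylinder_metric:
  assumes "p $ 3 > 0"
  shows "riemann cylinder_metric i j k l p = 0"
proof -
  have p: "p $ 3 \<noteq> 0" using assms by simp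
  show ?thesis
    by (simp add: riemann_def sum_4 christoffel_cylinder_metric[OF p]
        partial_christoffel_cylinder_metric[OF assms])
      (auto simp: power2_eq_square p)
qed

section \<open>Induction on the multipole order\<close>

theorem proposition1:
  fixes R c :: real and a f g :: "nat \<Rightarrow> real"
  assumes R_pos: "R > 0"
    and lambda_conv: "series_converges_abs_unif_on ({R..} \<times> {-1..1})
           (\<lambda>n (r, x). lambda_term a n r x)"
    and mu_conv: "double_series_converges_abs_unif_on ({R..} \<times> {-1..1})
           (\<lambda>n m (r, x). mu_term a n m r x)"
    and F_conv: "\<And>\<rho>. \<rho> \<ge> R \<Longrightarrow> summable (\<lambda>k. \<bar>f (Suc k) / \<rho> ^ Suc k\<bar>)"
    and G_conv: "\<And>z. \<bar>z\<bar> \<ge> R \<Longrightarrow> summable (\<lambda>k. \<bar>g (Suc k) / z ^ Suc k\<bar>)"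
    and separation: "\<And>\<rho> z. \<rho> > R \<Longrightarrow> \<bar>z\<bar> > R \<Longrightarrow>
           exp (2 * (in_weyl_coords (multipole_mu a) \<rho> z
                     - in_weyl_coords (multipole_lambda a) \<rho> z))
           = (1 - c + (\<Sum>k. f (Suc k) / \<rho> ^ Suc k)) + (c + (\<Sum>k. g (Suc k) / z ^ Suc k))"
  shows "(\<forall>n. a n = 0)
    \<and> (\<forall>r\<ge>R. \<forall>x\<in>{-1..1}. multipole_lambda a r x = 0 \<and> multipole_mu a r x = 0)
    \<and> flat_on {p. p $ 3 > 0 \<and> sqrt ((p $ 3)\<^sup>2 + (p $ 4)\<^sup>2) > R}
        (weyl_metric (in_weyl_coords (multipole_lambda a)) (in_weyl_coords (multipole_mu a)))"
proof -
  \<comment> \<open>The induction carries \<open>f\<close> and \<open>g\<close> along, since the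
    limits of F and G also need all lower orders to vanish. The index shift arises because
    \<open>a N\<close> enters \<lambda> at order N+1 in 1/r.\<close>
  have "a N = 0 \<and> f (Suc N) = 0 \<and> g (Suc N) = 0" for N
  proof (induction N rule: less_induct)
    case (less N)
    have "f (Suc N) / sqrt (1 - x\<^sup>2) ^ Suc N + g (Suc N) / x ^ Suc N = poly (smult (2 * a N) (legendre N)) x"
      if x: "0 < x" "x < 1" for x
    proof -
      define s where "s = sqrt (1 - x\<^sup>2)"
      have "x\<^sup>2 < 1" using x by (simp add: power_less_one_iff)
      then have s: "s > 0" "s\<^sup>2 + x\<^sup>2 = 1" by (simp_all add: s_def)
      define E where "E r = 2 * (multipole_mu a r x - multipole_lambda a r x)" for r
      have "summable (\<lambda>n. \<bar>a n * poly (legendre n) x / R ^ Suc n\<bar>)"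
        using lambda_conv x unfolding series_converges_abs_unif_on_def
        by (force simp: lambda_term_def)
      then have "((\<lambda>r. r ^ Suc N * (\<Sum>n. a n * poly (legendre n) x / r ^ Suc n))
          \<longlongrightarrow> a N * poly (legendre N) x) at_top"
        by (rule tendsto_tail_at_top[OF R_pos]) (use less in auto)
      moreover have "(\<lambda>(n, m). \<bar>mu_term a n m R x\<bar>) summable_on UNIV"
        using mu_conv x unfolding double_series_converges_abs_unif_on_def by force
      then have "((\<lambda>r. r ^ Suc N * multipole_mu a r x) \<longlongrightarrow> 0) at_top"
        by (rule multipole_mu_decay[OF R_pos]) (use less in auto)
      \<comment> \<open>The sum is added because \<lambda> is minus this series and enters
        \<open>E\<close> with a minus sign.\<close>
      ultimately have "((\<lambda>r. 2 * (r ^ Suc N * multipole_mu a r x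
            + r ^ Suc N * (\<Sum>n. a n * poly (legendre n) x / r ^ Suc n)))
          \<longlongrightarrow> 2 * (0 + a N * poly (legendre N) x)) at_top"
        by (intro tendsto_mult_left tendsto_add)
      then have "((\<lambda>r. r ^ Suc N * E r) \<longlongrightarrow> 2 * a N * poly (legendre N) x) at_top"
        by (simp add: E_def multipole_lambda_def lambda_term_def algebra_simps)
      then have exp_lim: "((\<lambda>r. r ^ Suc N * (exp (E r) - 1)) \<longlongrightarrow> 2 * a N * poly (legendre N) x) at_top"
        by (rule tendsto_pow_mult_exp_minus_one)
      \<comment> \<open>On the ray \<rho> = r s: the powers of \<open>s\<close> go into the
        coefficients, and the bound \<rho> \<ge> R becomes r \<ge> R/s. The same is done for z = r x
        below.\<close>
      have "summable (\<lambda>k. \<bar>f (Suc k) / s ^ Suc k / (R / s) ^ Suc k\<bar>)"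
        using F_conv[of R] s by (simp add: power_divide)
      then have f_lim: "((\<lambda>r. r ^ Suc N * (\<Sum>k. f (Suc k) / s ^ Suc k / r ^ Suc k))
          \<longlongrightarrow> f (Suc N) / s ^ Suc N) at_top"
        by (rule tendsto_tail_at_top[rotated]) (use less R_pos s in auto)
      have "summable (\<lambda>k. \<bar>g (Suc k) / x ^ Suc k / (R / x) ^ Suc k\<bar>)"
        using G_conv[of R] x by (simp add: power_divide)
      then have g_lim: "((\<lambda>r. r ^ Suc N * (\<Sum>k. g (Suc k) / x ^ Suc k / r ^ Suc k))
          \<longlongrightarrow> g (Suc N) / x ^ Suc N) at_top"
        by (rule tendsto_tail_at_top[rotated]) (use less R_pos x in auto)
      \<comment> \<open>Beyond R/s and R/x the point (r s, r x) lies where the separation equation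
        holds; there \<open>c\<close> cancels, and the remaining 1 is subtracted from the
        exponential.\<close>
      have "\<forall>\<^sub>F r in at_top. r ^ Suc N * (\<Sum>k. f (Suc k) / s ^ Suc k / r ^ Suc k)
            + r ^ Suc N * (\<Sum>k. g (Suc k) / x ^ Suc k / r ^ Suc k)
          = r ^ Suc N * (exp (E r) - 1)"
        using eventually_gt_at_top[of "R / s"] eventually_gt_at_top[of "R / x"]
      proof eventually_elim
        case (elim r)
        have "r > 0" using elim(1) R_pos s by (meson divide_pos_pos less_trans)
        have "sqrt ((r * s)\<^sup>2 + (r * x)\<^sup>2) = sqrt (r\<^sup>2 * (s\<^sup>2 + x\<^sup>2))"
          by (simp add: power_mult_distrib distrib_left)
        also have "\<dots> = r" using \<open>r > 0\<close> s by simp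
        finally have "in_weyl_coords h (r * s) (r * x) = h r x" for h
          using \<open>r > 0\<close> by (simp add: in_weyl_coords_def)
        then have "exp (E r) - 1 = (\<Sum>k. f (Suc k) / (r * s) ^ Suc k) + (\<Sum>k. g (Suc k) / (r * x) ^ Suc k)"
          using separation[of "r * s" "r * x"] elim s x R_pos \<open>r > 0\<close>
          by (simp add: E_def field_simps)
        then show ?case
          by (simp add: power_mult_distrib mult.commute distrib_left del: power_Suc)
      qed
      with tendsto_add[OF f_lim g_lim]
      have "((\<lambda>r. r ^ Suc N * (exp (E r) - 1)) \<longlongrightarrow> f (Suc N) / s ^ Suc N + g (Suc N) / x ^ Suc N) at_top"
        by (rule Lim_transform_eventually)
      from tendsto_unique[OF _ this exp_lim] show ?thesis
        by (simp add: s_def)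
    qed
    from separated_homogeneous_eq_poly_imp_zero[OF this] show ?case
      using legendre_nonzero[of N] by simp
  qed
  then have a: "a n = 0" for n by blast
  then have lam: "multipole_lambda a = (\<lambda>_ _. 0)" and mu: "multipole_mu a = (\<lambda>_ _. 0)"
    by (simp_all add: fun_eq_iff multipole_lambda_def lambda_term_def multipole_mu_def mu_term_def
        case_prod_unfold)
  \<comment> \<open>Both potentials vanish at all arguments, so the metrics agree as functions and
    their curvatures coincide without a local argument.\<close>
  then have "weyl_metric (in_weyl_coords (multipole_lambda a)) (in_weyl_coords (multipole_mu a)) = cylinder_metric"
    by (simp add: cylinder_metric_def in_weyl_coords_def[abs_def])
  then show ?thesis
    using a lam mu by (simp add: flat_on_def riemann_cylinder_metric)
qed

end
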